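(* Let $T$ be a positive integer, $\beta\in[0,1)$, $W>0$ an even integer and $r>0$ an integer. Let $\mathcal{A}_{flip}$ (resp. $\mathcal{A}_{occ}$) be an algorithm for $\mathbf{blocklist}_{flip}(W)$ (resp. $\mathbf{blocklist}_{occ}(W)$) such that, given an arbitrary turnstile stream $x$ of length $T$, with probability at least $1-\beta$ it has no false negatives and at most $r$ false positives. Then $\mathcal{A}_{flip}$ and $\mathcal{A}_{occ}$ use space at least $$(1-\beta)\cdot\left(\log(1-\beta)+\frac{T}{2W}\log\frac{WT}{T+2Wr}\right).$$
   Context: All logarithms are base 2. A turnstile stream over universe $\mathcal{U}$ is $x=(x_1,\dots,x_T)$ with each $x_t$ an insertion $+u$, a deletion $-u$ ($u\in\mathcal{U}$), or $\perp$. The frequency of $u$ at time $t$ is the number of insertions minus deletions of $u$ among $x_1,\dots,x_t$; $u$ is present at time $t$ if its frequency is positive and absent otherwise. The flippancy of $u$ in a stream is the number of timesteps at which $u$ switches from present to absent or vice versa; the occurrency of $u$ is the number of timesteps at which $u$ appears (as insertion or deletion). For the problem $\mathbf{blocklist}_{flip}(W)$ (resp. $\mathbf{blocklist}_{occ}(W)$), the ground truth on $x$ is $o^*(x)=(o^*_1,\dots,o^*_T)$ where $o^*_t=0$ if $x_t=\perp$ or if the item of $x_t$ has flippancy $<W$ (resp. occurrency $<W$) in the prefix $(x_1,\dots,x_{t-1})$, and $o^*_t=1$ otherwise. An algorithm processes the stream online and outputs $o(x)=(o_1,\dots,o_T)$, $o_t$ at time $t$; it has a false negative at $t$ if $o_t=0$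 and $o^*_t=1$, and a false positive at $t$ if $o_t=1$ and $o^*_t=0$. Space is the number of bits of the algorithm's memory state. The lower bound applies to all algorithms, including non-private and computationally unbounded ones.
   Formalization: The universe is assumed infinite or of size at least T/2, and the factor T/(2W) before the logarithm is replaced by its floor unless 2W divides T; without these the bound fails (e.g. T=W large, r=1, β=0, or a one-item universe). *)

theory Defs
  imports "HOL-Probability.Probability"
begin

datatype 'u update = Ins 'u | Del 'u | Idle

fun item :: "'u update \<Rightarrow> 'u option" where
  "item (Ins u) = Some u"
| "item (Del u) = Some u"
| "item Idle = None"

definition freq :: "'u update list \<Rightarrow> 'u \<Rightarrow> nat \<Rightarrow> int" where
  "freq x u t = int (count_list (take t x) (Ins u)) - int (count_list (take t x) (Del u))"

definition present :: "'u update list \<Rightarrow> 'u \<Rightarrow> nat \<Rightarrow> bool" where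
  "present x u t \<longleftrightarrow> freq x u t > 0"

text \<open>The update of timestep \<open>t = 1, \<dots>, length x\<close> is the list entry \<open>x ! (t - 1)\<close>; at time \<open>0\<close>
  every item is absent.\<close>

definition flippancy :: "'u update list \<Rightarrow> 'u \<Rightarrow> nat" where
  "flippancy x u = card {t \<in> {1..length x}. present x u t \<noteq> present x u (t - 1)}"

definition occurrency :: "'u update list \<Rightarrow> 'u \<Rightarrow> nat" where
  "occurrency x u = card {t \<in> {1..length x}. item (x ! (t - 1)) = Some u}"

definition blocklist ::
    "('u update list \<Rightarrow> 'u \<Rightarrow> nat) \<Rightarrow> nat \<Rightarrow> 'u update list \<Rightarrow> nat \<Rightarrow> bool" where
  "blocklist stat W x t \<longleftrightarrow>
     (case item (x ! (t - 1)) of None \<Rightarrow> False | Some u \<Rightarrow> stat (take (t - 1) x) u \<ge> W)"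

definition blocklist_flip :: "nat \<Rightarrow> 'u update list \<Rightarrow> nat \<Rightarrow> bool" where
  "blocklist_flip W = blocklist flippancy W"

definition blocklist_occ :: "nat \<Rightarrow> 'u update list \<Rightarrow> nat \<Rightarrow> bool" where
  "blocklist_occ W = blocklist occurrency W"

text \<open>A randomized online algorithm whose memory between timesteps consists of \<open>mem_bits\<close> bits.
  The random seed, drawn once from \<open>coins\<close>, and the clock are available at every step and are not
  charged to the space; fresh coins per step are the special case in which each step reads its own
  part of the seed. The step function is arbitrary (no computability or privacy requirement).\<close>

record ('u, 'w) streaming_alg =
  mem_bits :: nat
  coins :: "'w measure"
  init_mem :: "'w \<Rightarrow> bool list"
  step :: "'w \<Rightarrow> nat \<Rightarrow> bool list \<Rightarrow> 'u update \<Rightarrow> bool list \<times> bool"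

definition streaming_algorithm :: "('u, 'w) streaming_alg \<Rightarrow> bool" where
  "streaming_algorithm A \<longleftrightarrow>
     prob_space (coins A) \<and>
     (\<forall>\<omega> \<in> space (coins A). length (init_mem A \<omega>) = mem_bits A) \<and>
     (\<forall>\<omega> \<in> space (coins A). \<forall>t m a. length m = mem_bits A \<longrightarrow>
        length (fst (step A \<omega> t m a)) = mem_bits A)"

fun run_from :: "('u, 'w) streaming_alg \<Rightarrow> 'w \<Rightarrow> nat \<Rightarrow> bool list \<Rightarrow> 'u update list \<Rightarrow> bool list" where
  "run_from A \<omega> t m [] = []"
| "run_from A \<omega> t m (a # x) = (case step A \<omega> t m a of (m', b) \<Rightarrow> b # run_from A \<omega> (Suc t) m' x)"

definition outputs :: "('u, 'w) streaming_alg \<Rightarrow> 'w \<Rightarrow> 'u update list \<Rightarrow> bool list" where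
  "outputs A \<omega> x = run_from A \<omega> 1 (init_mem A \<omega>) x"

definition false_negatives ::
    "('u update list \<Rightarrow> nat \<Rightarrow> bool) \<Rightarrow> 'u update list \<Rightarrow> bool list \<Rightarrow> nat set" where
  "false_negatives truth x out = {t \<in> {1..length x}. \<not> out ! (t - 1) \<and> truth x t}"

definition false_positives ::
    "('u update list \<Rightarrow> nat \<Rightarrow> bool) \<Rightarrow> 'u update list \<Rightarrow> bool list \<Rightarrow> nat set" where
  "false_positives truth x out = {t \<in> {1..length x}. out ! (t - 1) \<and> \<not> truth x t}"

text \<open>For \<open>\<beta> < 1\<close> the inequality below forces the success event to be measurable, because
  \<^const>\<open>measure\<close> is \<open>0\<close> on non-measurable sets.\<close>

definition accurate ::
    "('u update list \<Rightarrow> nat \<Rightarrow> bool) \<Rightarrow> nat \<Rightarrow> real \<Rightarrow> nat \<Rightarrow> ('u, 'w) streaming_alg \<Rightarrow> bool" where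
  "accurate truth T \<beta> r A \<longleftrightarrow>
     (\<forall>x. length x = T \<longrightarrow>
        measure (coins A) {\<omega> \<in> space (coins A).
          false_negatives truth x (outputs A \<omega> x) = {} \<and>
          card (false_positives truth x (outputs A \<omega> x)) \<le> r} \<ge> 1 - \<beta>)"

end

theory Submission
  imports Defs
begin

text \<open>
  Let \<open>n = \<lceil>T/2\<rceil>\<close> and \<open>k = \<lfloor>T/(2W)\<rfloor>\<close>. A \<open>k\<close>-subset \<open>S\<close> of \<open>n\<close> fixed items is encoded by
  inserting and deleting each item of \<open>S\<close> alternately, \<open>W\<close> updates per item; afterwards every one
  of the \<open>n\<close> items is inserted once. On a successful run the items flagged in the second phase form a
  superset of \<open>S\<close> with at most \<open>k + r\<close> elements, and this superset depends only on the seed and the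
  memory after the first phase. Hence for each seed at most \<open>2^s * (k + r choose k)\<close> sets are
  handled successfully, where \<open>s\<close> is the number of memory bits. Averaging over the seed yields
  \<open>(1 - \<beta>) * (n choose k) \<le> 2^s * (k + r choose k)\<close>, and
  \<open>(n choose k) / (k + r choose k) \<ge> (n / (k + r))^k\<close> if \<open>n \<ge> k + r\<close>.
\<close>

section \<open>Splitting a run\<close>

fun mem_after :: "('u, 'w) streaming_alg \<Rightarrow> 'w \<Rightarrow> nat \<Rightarrow> bool list \<Rightarrow> 'u update list \<Rightarrow> bool list" where
  "mem_after A \<omega> t m [] = m"
| "mem_after A \<omega> t m (a # x) = mem_after A \<omega> (Suc t) (fst (step A \<omega> t m a)) x"

lemma length_run_from [simp]: "length (run_from A \<omega> t m x) = length x"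
  by (induction x arbitrary: t m) (auto split: prod.split)

text \<open>For a fixed seed, the prefix affects later outputs only through the memory and the
  elapsed time. The memory thus acts as the message from which the prefix is decoded.\<close>

lemma run_from_append:
  "run_from A \<omega> t m (x @ y) =
     run_from A \<omega> t m x @ run_from A \<omega> (t + length x) (mem_after A \<omega> t m x) y"
  by (induction x arbitrary: t m) (auto split: prod.split)

lemma length_mem_after:
  assumes "streaming_algorithm A" "\<omega> \<in> space (coins A)" "length m = mem_bits A"
  shows "length (mem_after A \<omega> t m x) = mem_bits A"
  using assms(3)
proof (induction x arbitrary: t m)
  case (Cons a x)
  then have "length (fst (step A \<omega> t m a)) = mem_bits A"
    using assms(1,2) by (auto simp: streaming_algorithm_def)
  then show ?case by (simp add: Cons.IH)
qed simp

section \<open>Counting\<close>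

text \<open>Division-free form of (n choose k) / (K choose k) >= (n / K)^k: the quotient is a
  product of factors (n - i) / (K - i), each at least n / K. The induction peels off one factor by
  absorption; truncated subtraction also covers k > K.\<close>

lemma binomial_mult_power_le:
  fixes K n k :: nat
  assumes "K \<le> n"
  shows "(K choose k) * n ^ k \<le> (n choose k) * K ^ k"
proof (induction k)
  case (Suc k)
  have absorb: "Suc k * (m choose Suc k) = (m - k) * (m choose k)" for m :: nat
    by (simp only: binomial_absorption binomial_absorb_comp)
  have factor: "(K - k) * n \<le> (n - k) * K"
    using assms by (simp add: diff_mult_distrib mult.commute[of n K] diff_le_mono2)
  have "Suc k * ((K choose Suc k) * n ^ Suc k) = ((K - k) * n) * ((K choose k) * n ^ k)"
    by (metis absorb mult.assoc mult.left_commute power_Suc)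
  also have "\<dots> \<le> ((n - k) * K) * ((n choose k) * K ^ k)"
    using factor Suc.IH by (rule mult_le_mono)
  also have "\<dots> = Suc k * ((n choose Suc k) * K ^ Suc k)"
    by (metis absorb mult.assoc mult.left_commute power_Suc)
  finally show ?case by (simp only: Suc_mult_le_cancel1)
qed simp

text \<open>Double counting: the sum of the indicators at a point is the number of events containing
  it, and expectation commutes with the finite sum.\<close>

lemma (in prob_space) sum_prob_le:
  assumes "finite I" "\<And>i. i \<in> I \<Longrightarrow> E i \<in> events"
    and "\<And>\<omega>. \<omega> \<in> space M \<Longrightarrow> card {i \<in> I. \<omega> \<in> E i} \<le> b"
  shows "(\<Sum>i\<in>I. prob (E i)) \<le> real b"
proof -
  have integrable: "integrable M (indicator (E i) :: _ \<Rightarrow> real)" if "i \<in> I" for i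
    using assms(2)[OF that] by (intro integrable_real_indicator) (auto simp: emeasure_eq_measure)
  have "(\<Sum>i\<in>I. prob (E i)) = (\<Sum>i\<in>I. expectation (indicator (E i)))"
    using assms(2) by (intro sum.cong refl) (simp add: sets.Int_space_eq2)
  also have "\<dots> = expectation (\<lambda>\<omega>. \<Sum>i\<in>I. indicator (E i) \<omega>)"
    using integrable by (subst Bochner_Integration.integral_sum) auto
  also have "\<dots> \<le> expectation (\<lambda>\<omega>. real b)"
  proof (rule integral_mono)
    show "integrable M (\<lambda>\<omega>. \<Sum>i\<in>I. indicator (E i) \<omega> :: real)"
      using integrable by auto
    show "(\<Sum>i\<in>I. indicator (E i) \<omega>) \<le> real b" if "\<omega> \<in> space M" for \<omega>
    proof -
      have "(\<Sum>i\<in>I. indicator (E i) \<omega>) = real (card {i \<in> I. \<omega> \<in> E i})"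
        using assms(1) by (simp add: indicator_def sum.If_cases Int_def)
      then show ?thesis using assms(3)[OF that] by simp
    qed
  qed simp
  also have "\<dots> = real b" by (simp add: prob_space)
  finally show ?thesis .
qed

text \<open>A single such \<open>S\<close> already forces \<open>card X\<close> to be at most k + r;
  then all k-subsets of \<open>X\<close> may be counted.\<close>

lemma card_subsets_small_complement_le:
  assumes "finite X"
  shows "card {S. S \<subseteq> X \<and> card S = k \<and> card (X - S) \<le> r} \<le> (k + r choose k)"
proof (cases "{S. S \<subseteq> X \<and> card S = k \<and> card (X - S) \<le> r} = {}")
  case False
  then obtain S where S: "S \<subseteq> X" "card S = k" "card (X - S) \<le> r" by auto
  then have "card X \<le> k + r"
    using assms card_Diff_subset[of S X] finite_subset[of S X] by simp
  have "card {S. S \<subseteq> X \<and> card S = k \<and> card (X - S) \<le> r} \<le> card {S. S \<subseteq> X \<and> card S = k}"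
    using assms by (intro card_mono) auto
  also have "\<dots> = card X choose k" using n_subsets[OF assms] .
  also have "\<dots> \<le> (k + r choose k)" by (rule binomial_right_mono) fact
  finally show ?thesis .
next
  case True
  then show ?thesis by (simp only: card.empty)
qed

section \<open>Decoding a set from the memory\<close>

text \<open>Kept abstract in \<open>truth\<close> and \<open>enc\<close> so that it serves both
  problems. The common length \<open>p\<close> lets decoding start at a clock value independent of
  \<open>S\<close>.\<close>

lemma encoding_bound:
  fixes A :: "('u, 'w) streaming_alg"
  assumes alg: "streaming_algorithm A" and acc: "accurate truth T \<beta> r A" and "\<beta> < 1"
    and us: "distinct us" "length us = n"
    and len: "\<And>S. S \<subseteq> set us \<Longrightarrow> card S = k \<Longrightarrow> length (enc S) = p"
    and T: "p + n + length suf = T"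
    and truth: "\<And>S j. S \<subseteq> set us \<Longrightarrow> card S = k \<Longrightarrow> j < n \<Longrightarrow>
      truth (enc S @ map Ins us @ suf) (p + j + 1) \<longleftrightarrow> us ! j \<in> S"
  shows "(1 - \<beta>) * real (n choose k) \<le> 2 ^ mem_bits A * real (k + r choose k)"
proof -
  interpret prob_space "coins A"
    using alg by (simp add: streaming_algorithm_def)
  define F where "F = {S. S \<subseteq> set us \<and> card S = k}"
  define x where "x = (\<lambda>S. enc S @ map Ins us @ suf)"
  define E where "E = (\<lambda>S. {\<omega> \<in> space (coins A).
    false_negatives truth (x S) (outputs A \<omega> (x S)) = {} \<and>
    card (false_positives truth (x S) (outputs A \<omega> (x S))) \<le> r})"
  \<comment> \<open>The decoder: it replays the query phase from the seed and a memory state,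
    without access to \<open>S\<close>.\<close>
  define flagged where "flagged = (\<lambda>\<omega> m.
    {us ! j |j. j < n \<and> run_from A \<omega> (1 + p) m (map Ins us @ suf) ! j})"
  define M where "M = {m :: bool list. length m = mem_bits A}"
  have finF: "finite F" by (simp add: F_def)
  have cardF: "card F = (n choose k)"
    using n_subsets[of "set us" k] us by (simp add: F_def distinct_card)
  have finM: "finite M" and cardM: "card M = 2 ^ mem_bits A"
    using finite_lists_length_eq[of "UNIV :: bool set" "mem_bits A"]
      card_lists_length_eq[of "UNIV :: bool set" "mem_bits A"] by (auto simp: M_def)
  have prob_E: "prob (E S) \<ge> 1 - \<beta>" if "S \<in> F" for S
  proof -
    have "length (x S) = T" using that len T us by (simp add: x_def F_def)
    then show ?thesis using acc by (auto simp: accurate_def E_def)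
  qed
  \<comment> \<open>Measurability comes for free: a non-measurable set has \<open>measure\<close> 0,
    which is below 1 - \<beta>.\<close>
  have events: "E S \<in> events" if "S \<in> F" for S
    using prob_E[OF that] \<open>\<beta> < 1\<close> measure_notin_sets[of "E S" "coins A"] by fastforce
  have finO: "finite (flagged \<omega> m)" for \<omega> m by (simp add: flagged_def)
  have decode: "\<exists>m\<in>M. S \<subseteq> flagged \<omega> m \<and> card (flagged \<omega> m - S) \<le> r"
    if S: "S \<in> F" and \<omega>: "\<omega> \<in> E S" for S \<omega>
  proof
    define m where "m = mem_after A \<omega> 1 (init_mem A \<omega>) (enc S)"
    have space: "\<omega> \<in> space (coins A)" using \<omega> by (simp add: E_def)
    show "m \<in> M" using space alg
      by (auto simp: m_def M_def streaming_algorithm_def intro!: length_mem_after[OF alg])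
    have lenS: "length (enc S) = p" using S len by (auto simp: F_def)
    have out: "outputs A \<omega> (x S) ! (p + j) = run_from A \<omega> (1 + p) m (map Ins us @ suf) ! j" for j
      using lenS by (simp add: outputs_def x_def run_from_append[of _ _ _ _ "enc S"] m_def nth_append)
    have tr: "truth (x S) (p + j + 1) \<longleftrightarrow> us ! j \<in> S" if "j < n" for j
      using truth[of S j] S that by (simp add: x_def F_def)
    have lenx: "length (x S) = p + n + length suf" using lenS us by (simp add: x_def)
    have "S \<subseteq> flagged \<omega> m"
    proof
      fix u assume "u \<in> S"
      then obtain j where j: "j < n" "u = us ! j"
        using S us by (auto simp: F_def in_set_conv_nth subset_iff)
      have "p + j + 1 \<notin> false_negatives truth (x S) (outputs A \<omega> (x S))"
        using \<omega> by (auto simp: E_def)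
      then have "outputs A \<omega> (x S) ! (p + j)"
        using j tr \<open>u \<in> S\<close> lenx by (auto simp: false_negatives_def)
      then show "u \<in> flagged \<omega> m" using j out by (auto simp: flagged_def)
    qed
    moreover have "card (flagged \<omega> m - S) \<le> r"
    proof -
      let ?P = "false_positives truth (x S) (outputs A \<omega> (x S))"
      \<comment> \<open>Item \<open>us ! j\<close> is queried at time p + j + 1, so each wrongly
        flagged item is the image of a false positive under the map from times back to
        items.\<close>
      have "flagged \<omega> m - S \<subseteq> (\<lambda>t. us ! (t - 1 - p)) ` ?P"
      proof
        fix u assume u: "u \<in> flagged \<omega> m - S"
        then obtain j where j: "j < n" "u = us ! j"
          "run_from A \<omega> (1 + p) m (map Ins us @ suf) ! j"
          by (auto simp: flagged_def)
        then have "p + j + 1 \<in> ?P"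
          using u tr[of j] out[of j] lenx by (simp add: false_positives_def)
        then have "us ! (p + j + 1 - 1 - p) \<in> (\<lambda>t. us ! (t - 1 - p)) ` ?P" by (rule imageI)
        then show "u \<in> (\<lambda>t. us ! (t - 1 - p)) ` ?P" using j by simp
      qed
      moreover have "finite ?P" by (simp add: false_positives_def)
      ultimately have "card (flagged \<omega> m - S) \<le> card ?P"
        by (meson card_image_le card_mono finite_imageI le_trans)
      then show ?thesis using \<omega> by (simp add: E_def)
    qed
    ultimately show "S \<subseteq> flagged \<omega> m \<and> card (flagged \<omega> m - S) \<le> r" ..
  qed
  have "card {S \<in> F. \<omega> \<in> E S} \<le> 2 ^ mem_bits A * (k + r choose k)" for \<omega>
  proof -
    \<comment> \<open>\<open>D m\<close> collects every set compatible with memory \<open>m\<close>;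
      by \<open>decode\<close>, each successful \<open>S\<close> lies in one of these
      families.\<close>
    define D where "D = (\<lambda>m. {S. S \<subseteq> flagged \<omega> m \<and> card S = k \<and> card (flagged \<omega> m - S) \<le> r})"
    have "{S \<in> F. \<omega> \<in> E S} \<subseteq> (\<Union>m\<in>M. D m)"
      using decode by (fastforce simp: D_def F_def)
    then have "card {S \<in> F. \<omega> \<in> E S} \<le> card (\<Union>m\<in>M. D m)"
      using finM finO by (intro card_mono) (auto simp: D_def)
    also have "\<dots> \<le> (\<Sum>m\<in>M. card (D m))" by (rule card_UN_le[OF finM])
    also have "\<dots> \<le> (\<Sum>m\<in>M. (k + r choose k))"
      unfolding D_def by (intro sum_mono card_subsets_small_complement_le finO)
    finally show ?thesis by (simp add: cardM)
  qed
  then have "(\<Sum>S\<in>F. prob (E S)) \<le> real (2 ^ mem_bits A * (k + r choose k))"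
    by (intro sum_prob_le finF events) auto
  moreover have "(\<Sum>S\<in>F. 1 - \<beta>) \<le> (\<Sum>S\<in>F. prob (E S))"
    by (intro sum_mono prob_E)
  ultimately show ?thesis by (simp add: cardF mult.commute)
qed

section \<open>Counting statistics of an item\<close>

abbreviation final_freq :: "'u update list \<Rightarrow> 'u \<Rightarrow> int" where
  "final_freq x u \<equiv> freq x u (length x)"

text \<open>What the encoding needs from either statistic. Starting at frequency 0, an insertion
  makes the item present and the following deletion makes it absent, so the pair adds two flips as
  well as two occurrences.\<close>

locale update_statistic =
  fixes stat :: "'u update list \<Rightarrow> 'u \<Rightarrow> nat"
  assumes stat_Nil: "stat [] u = 0"
    and stat_snoc_other: "item a \<noteq> Some u \<Longrightarrow> stat (x @ [a]) u = stat x u"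
    and stat_Ins_Del: "final_freq x u = 0 \<Longrightarrow> stat (x @ [Ins u, Del u]) u = stat x u + 2"

text \<open>Two predicates are needed because the timestep condition itself mentions the list, which
  grows from \<open>x\<close> to \<open>x @ [a]\<close>.\<close>

lemma card_timesteps_snoc:
  assumes "\<And>t. t \<in> {1..length x} \<Longrightarrow> P t \<longleftrightarrow> Q t"
  shows "card {t \<in> {1..length (x @ [a])}. P t} =
    card {t \<in> {1..length x}. Q t} + of_bool (P (Suc (length x)))"
proof -
  have "{t \<in> {1..length (x @ [a])}. P t} =
      (if P (Suc (length x)) then insert (Suc (length x)) {t \<in> {1..length x}. Q t}
       else {t \<in> {1..length x}. Q t})"
    using assms by (auto simp: le_Suc_eq)
  then show ?thesis by simp
qed

lemma flippancy_snoc: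
  "flippancy (x @ [a]) u =
     flippancy x u + of_bool ((final_freq (x @ [a]) u > 0) \<noteq> (final_freq x u > 0))"
proof -
  have "present (x @ [a]) u t = present x u t" if "t \<le> length x" for t
    using that by (simp add: present_def freq_def)
  then show ?thesis
    unfolding flippancy_def
    by (subst card_timesteps_snoc[where Q = "\<lambda>t. present x u t \<noteq> present x u (t - 1)"])
      (auto simp: present_def)
qed

lemma occurrency_snoc: "occurrency (x @ [a]) u = occurrency x u + of_bool (item a = Some u)"
  unfolding occurrency_def
  by (subst card_timesteps_snoc[where Q = "\<lambda>t. item (x ! (t - 1)) = Some u"])
    (auto simp: nth_append)

interpretation flip: update_statistic flippancy
proof
  fix x :: "'a update list" and a and u :: 'a
  show "flippancy [] u = 0" by (simp add: flippancy_def)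
  show "flippancy (x @ [a]) u = flippancy x u" if "item a \<noteq> Some u"
    using that by (cases a) (auto simp: flippancy_snoc freq_def)
  show "flippancy (x @ [Ins u, Del u]) u = flippancy x u + 2" if "final_freq x u = 0"
    using that flippancy_snoc[of "x @ [Ins u]" "Del u" u]
    by (simp add: flippancy_snoc freq_def)
qed

interpretation occ: update_statistic occurrency
proof
  fix x :: "'a update list" and a and u :: 'a
  show "occurrency [] u = 0" by (simp add: occurrency_def)
  show "occurrency (x @ [a]) u = occurrency x u" if "item a \<noteq> Some u"
    using that by (simp add: occurrency_snoc)
  show "occurrency (x @ [Ins u, Del u]) u = occurrency x u + 2" if "final_freq x u = 0"
    using occurrency_snoc[of "x @ [Ins u]" "Del u" u] by (simp add: occurrency_snoc)
qed

section \<open>Encoding a set by alternating insertions and deletions\<close>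

definition alternation :: "nat \<Rightarrow> 'u \<Rightarrow> 'u update list" where
  "alternation h u = concat (replicate h [Ins u, Del u])"

lemma alternation_Suc: "alternation (Suc h) u = alternation h u @ [Ins u, Del u]"
  unfolding alternation_def by (simp flip: replicate_append_same)

lemma length_alternation: "length (alternation h u) = 2 * h"
  by (induction h) (auto simp: alternation_Suc alternation_def[of 0])

lemma item_alternation: "a \<in> set (alternation h u) \<Longrightarrow> item a = Some u"
  by (induction h) (auto simp: alternation_Suc alternation_def[of 0])

text \<open>Keeps every frequency at 0 throughout the encoding, so that \<open>stat_Ins_Del\<close>
  applies to each new pair.\<close>

lemma final_freq_append_alternation: "final_freq (x @ alternation h u) v = final_freq x v"
  by (induction h) (auto simp: alternation_Suc alternation_def[of 0] freq_def)

definition encode :: "nat \<Rightarrow> 'u list \<Rightarrow> 'u update list" where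
  "encode h xs = concat (map (alternation h) xs)"

lemma encode_simps: "encode h [] = []" "encode h (xs @ [u]) = encode h xs @ alternation h u"
  by (simp_all add: encode_def)

lemma length_encode: "length (encode h xs) = length xs * (2 * h)"
  by (induction xs) (auto simp: encode_def length_alternation)

lemma final_freq_encode: "final_freq (encode h xs) v = 0"
proof (induction xs rule: rev_induct)
  case Nil
  show ?case by (simp add: encode_simps freq_def)
next
  case (snoc u xs)
  then show ?case by (simp only: encode_simps final_freq_append_alternation)
qed

context update_statistic
begin

lemma stat_append_other:
  assumes "\<And>a. a \<in> set y \<Longrightarrow> item a \<noteq> Some u"
  shows "stat (x @ y) u = stat x u"
  using assms
proof (induction y rule: rev_induct)
  case (snoc a y)
  then show ?case using stat_snoc_other[of a u "x @ y"] by simp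
qed simp

lemma stat_append_alternation:
  assumes "final_freq x u = 0"
  shows "stat (x @ alternation h u) u = stat x u + 2 * h"
proof (induction h)
  case (Suc h)
  have "final_freq (x @ alternation h u) u = 0"
    using assms by (simp only: final_freq_append_alternation)
  from stat_Ins_Del[OF this] Suc show ?case by (simp add: alternation_Suc)
qed (simp add: alternation_def)

lemma stat_encode:
  assumes "distinct xs"
  shows "stat (encode h xs) v = (if v \<in> set xs then 2 * h else 0)"
  using assms
proof (induction xs rule: rev_induct)
  case Nil
  show ?case by (simp add: encode_simps stat_Nil)
next
  case (snoc u xs)
  show ?case
  proof (cases "v = u")
    case True
    then show ?thesis
      using snoc by (simp add: encode_simps stat_append_alternation final_freq_encode)
  next
    case False
    then have "stat (encode h xs @ alternation h u) v = stat (encode h xs) v"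
      by (intro stat_append_other) (auto dest: item_alternation)
    then show ?thesis using snoc False by (simp add: encode_simps)
  qed
qed

text \<open>The prefix before the query of \<open>us ! j\<close> contains only queries of other
  items, so the statistic is still exactly \<open>2 * h\<close> or 0, and h > 0 separates the two
  cases.\<close>

lemma blocklist_encode:
  assumes "distinct xs" "distinct us" "j < length us" "h > 0"
  shows "blocklist stat (2 * h) (encode h xs @ map Ins us @ suf) (length (encode h xs) + j + 1)
    \<longleftrightarrow> us ! j \<in> set xs"
proof -
  have "us ! j \<notin> set (take j us)"
    using assms(2,3) by (auto simp: in_set_conv_nth nth_eq_iff_index_eq)
  then have "stat (encode h xs @ map Ins (take j us)) (us ! j) = stat (encode h xs) (us ! j)"
    by (intro stat_append_other) auto
  then show ?thesis
    using assms by (simp add: blocklist_def nth_append take_map stat_encode)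
qed

section \<open>The space bound\<close>

lemma blocklist_binomial_bound:
  fixes A :: "('u, 'w) streaming_alg"
  assumes "streaming_algorithm A" "accurate (blocklist stat W) T \<beta> r A" "\<beta> < 1"
    and "W > 0" "even W" "k * W + n \<le> T"
    and universe: "infinite (UNIV :: 'u set) \<or> n \<le> card (UNIV :: 'u set)"
  shows "(1 - \<beta>) * real (n choose k) \<le> 2 ^ mem_bits A * real (k + r choose k)"
proof -
  obtain h where h: "W = 2 * h" using \<open>even W\<close> by auto
  obtain U :: "'u set" where "finite U" "card U = n"
    using universe infinite_arbitrarily_large obtain_subset_with_card_n by meson
  then obtain us where us: "set us = U" "distinct us" "length us = n"
    by (metis distinct_card finite_distinct_list)
  \<comment> \<open>\<open>encode\<close> takes a list, so one ordering of each set is fixed by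
    choice.\<close>
  define enum where "enum = (\<lambda>S :: 'u set. SOME xs. set xs = S \<and> distinct xs)"
  have enum: "set (enum S) = S \<and> distinct (enum S)" if "S \<subseteq> set us" for S
    unfolding enum_def using that finite_distinct_list[of S] finite_subset[of S "set us"]
    by (intro someI_ex[of "\<lambda>xs. set xs = S \<and> distinct xs"]) simp
  have len: "length (encode h (enum S)) = k * W" if "S \<subseteq> set us" "card S = k" for S
    using enum[OF that(1)] that(2) distinct_card[of "enum S"] by (simp add: length_encode h)
  show ?thesis
  proof (rule encoding_bound[OF assms(1-3) us(2,3) len])
    \<comment> \<open>\<open>accurate\<close> speaks only of streams of length exactly
      \<open>T\<close>; idle steps fill the rest.\<close>
    show "k * W + n + length (replicate (T - (k * W + n)) Idle) = T"
      using assms by simp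
    show "blocklist stat W (encode h (enum S) @ map Ins us @ replicate (T - (k * W + n)) Idle)
        (k * W + j + 1) \<longleftrightarrow> us ! j \<in> S" if "S \<subseteq> set us" "card S = k" "j < n" for S j
      using blocklist_encode[of "enum S" us j h] enum[OF that(1)] us that len[OF that(1,2)] h \<open>W > 0\<close>
      by simp
  qed
qed

lemma blocklist_space_bound:
  fixes A :: "('u, 'w) streaming_alg"
  assumes "streaming_algorithm A" "accurate (blocklist stat W) T \<beta> r A" "0 \<le> \<beta>" "\<beta> < 1"
    and "T > 0" "W > 0" "even W" "r > 0"
    and universe: "infinite (UNIV :: 'u set) \<or> T \<le> 2 * card (UNIV :: 'u set)"
  shows "real (mem_bits A) \<ge> (1 - \<beta>) * (log 2 (1 - \<beta>) +
    real (T div (2 * W)) * log 2 (real W * real T / (real T + 2 * real W * real r)))"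
proof -
  \<comment> \<open>Encoding takes k * W <= T / 2 updates, which leaves room for ceil(T / 2)
    queries.\<close>
  define k where "k = T div (2 * W)"
  define n where "n = (T + 1) div 2"
  \<comment> \<open>A lower bound on n / (k + r), obtained from n >= T / 2 and k <= T / (2
    W).\<close>
  define q where "q = real W * real T / (real T + 2 * real W * real r)"
  define L where "L = log 2 (1 - \<beta>) + real k * log 2 q"
  have q_pos: "q > 0" using assms by (simp add: q_def add_pos_pos)
  \<comment> \<open>If q <= 1, both terms of \<open>L\<close> are nonpositive. Otherwise q > 1
    supplies k + r <= n, the hypothesis of the binomial estimate.\<close>
  have "L \<le> real (mem_bits A)"
  proof (cases "q \<le> 1")
    case True
    then have "log 2 q \<le> 0" using q_pos by simp
    moreover have "log 2 (1 - \<beta>) \<le> 0" using assms by simp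
    ultimately have "L \<le> 0" by (simp add: L_def mult_nonneg_nonpos add_nonpos_nonpos)
    then show ?thesis by simp
  next
    case False
    have n_ge: "real n \<ge> real T / 2" unfolding n_def by linarith
    have "k * (2 * W) \<le> T" by (simp add: k_def)
    then have kW: "2 * (k * W) \<le> T" by simp
    then have "k * W + n \<le> T" unfolding n_def by linarith
    moreover have "infinite (UNIV :: 'u set) \<or> n \<le> card (UNIV :: 'u set)"
      using universe unfolding n_def by linarith
    ultimately have bound: "(1 - \<beta>) * real (n choose k) \<le> 2 ^ mem_bits A * real (k + r choose k)"
      using assms by (intro blocklist_binomial_bound[of A W T]) auto
    have "2 * (real k * real W) \<le> real T" using kW by (metis of_nat_mult of_nat_numeral of_nat_le_iff)
    then have k_le: "2 * real W * real (k + r) \<le> real T + 2 * real W * real r"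
      by (simp add: algebra_simps)
    have "q * real (k + r) \<le> real T / 2"
    proof -
      have "real T * (2 * real W * real (k + r)) \<le> real T * (real T + 2 * real W * real r)"
        using k_le by (intro mult_left_mono) auto
      moreover have "real T + 2 * real W * real r > 0" using assms by (simp add: add_pos_pos)
      ultimately show ?thesis by (simp add: q_def field_simps)
    qed
    then have qn: "q * real (k + r) \<le> real n" using n_ge by simp
    moreover have "1 * real (k + r) \<le> q * real (k + r)" using False by (intro mult_right_mono) auto
    ultimately have "real (k + r) \<le> real n" by (simp only: mult_1_left)
    then have "k + r \<le> n" by (simp only: of_nat_le_iff)
    then have "(k + r choose k) * n ^ k \<le> (n choose k) * (k + r) ^ k"
      by (rule binomial_mult_power_le)
    then have ratio: "real (k + r choose k) * real n ^ k \<le> real (n choose k) * real (k + r) ^ k"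
      by (metis of_nat_le_iff of_nat_mult of_nat_power)
    have K_pos: "real (k + r) ^ k > 0" using \<open>r > 0\<close> by simp
    have C_pos: "real (k + r choose k) > 0" by simp
    have "real (k + r choose k) * q ^ k * real (k + r) ^ k =
        real (k + r choose k) * (q * real (k + r)) ^ k"
      by (simp add: power_mult_distrib)
    also have "\<dots> \<le> real (k + r choose k) * real n ^ k"
      using qn q_pos by (intro mult_left_mono power_mono) auto
    also note ratio
    finally have "real (k + r choose k) * q ^ k \<le> real (n choose k)"
      using K_pos by (rule mult_right_le_imp_le)
    then have "(1 - \<beta>) * (real (k + r choose k) * q ^ k) \<le> (1 - \<beta>) * real (n choose k)"
      using assms by (intro mult_left_mono) auto
    also note bound
    finally have "((1 - \<beta>) * q ^ k) * real (k + r choose k) \<le> 2 ^ mem_bits A * real (k + r choose k)"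
      by (simp add: ac_simps)
    then have "(1 - \<beta>) * q ^ k \<le> 2 ^ mem_bits A"
      using C_pos by (rule mult_right_le_imp_le)
    then have "log 2 ((1 - \<beta>) * q ^ k) \<le> log 2 (2 ^ mem_bits A)"
      using assms q_pos by (subst log_le_cancel_iff) auto
    then show ?thesis
      using assms q_pos by (simp add: L_def log_mult log_nat_power)
  qed
  \<comment> \<open>The counting gives the bound \<open>L\<close> itself; the factor 1 - \<beta>, at
    most 1, only weakens it.\<close>
  then have "(1 - \<beta>) * L \<le> (1 - \<beta>) * real (mem_bits A)"
    using assms by (intro mult_left_mono) auto
  also have "\<dots> \<le> 1 * real (mem_bits A)"
    using assms by (intro mult_right_mono) auto
  finally show ?thesis by (simp add: L_def k_def q_def)
qed

end

text \<open>The number of encoded items is an integer, hence the floor; the exponent T / (2 W)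
  itself is asserted when 2 W divides T. The universe must supply ceil(T / 2) distinct items to
  query; the infinite case is listed separately because \<open>card\<close> of an infinite set is
  0.\<close>

theorem mainTheorem3:
  fixes T W r :: nat and \<beta> :: real
    and A_flip :: "('u, 'v) streaming_alg" and A_occ :: "('u, 'w) streaming_alg"
  assumes "T > 0" and "0 \<le> \<beta>" and "\<beta> < 1" and "W > 0" and "even W" and "r > 0"
    and universe: "infinite (UNIV :: 'u set) \<or> T \<le> 2 * card (UNIV :: 'u set)"
  shows
    "(streaming_algorithm A_flip \<and> accurate (blocklist_flip W) T \<beta> r A_flip \<longrightarrow>
        (2 * W dvd T \<longrightarrow>
          real (mem_bits A_flip) \<ge> (1 - \<beta>) * (log 2 (1 - \<beta>) +
            real T / (2 * real W) * log 2 (real W * real T / (real T + 2 * real W * real r)))) \<and>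
        real (mem_bits A_flip) \<ge> (1 - \<beta>) * (log 2 (1 - \<beta>) +
          \<lfloor>real T / (2 * real W)\<rfloor> * log 2 (real W * real T / (real T + 2 * real W * real r))))
     \<and> (streaming_algorithm A_occ \<and> accurate (blocklist_occ W) T \<beta> r A_occ \<longrightarrow>
        (2 * W dvd T \<longrightarrow>
          real (mem_bits A_occ) \<ge> (1 - \<beta>) * (log 2 (1 - \<beta>) +
            real T / (2 * real W) * log 2 (real W * real T / (real T + 2 * real W * real r)))) \<and>
        real (mem_bits A_occ) \<ge> (1 - \<beta>) * (log 2 (1 - \<beta>) +
          \<lfloor>real T / (2 * real W)\<rfloor> * log 2 (real W * real T / (real T + 2 * real W * real r))))"

proof -
  have floor: "\<lfloor>real T / (2 * real W)\<rfloor> = int (T div (2 * W))"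
    using floor_divide_of_nat_eq[of T "2 * W", where 'a = real] by simp
  have exact: "real T / (2 * real W) = real (T div (2 * W))" if "2 * W dvd T"
    using that by (simp add: real_of_nat_div)
  show ?thesis
    using flip.blocklist_space_bound[of A_flip W T \<beta> r] occ.blocklist_space_bound[of A_occ W T \<beta> r]
      assms
    by (simp add: floor exact blocklist_flip_def blocklist_occ_def)
qed

end
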